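(* For each $\gamma\in\mathbb{R}$ there exists a set $\mathcal{A}_\gamma\subset\mathbb{R}$ of full Lebesgue measure (i.e. whose complement has Lebesgue measure zero) such that for every $\alpha\in\mathcal{A}_\gamma$ there is a constant $C>0$ such that for all sufficiently large $N\in\mathbb{N}$ $$S_N(\alpha,\gamma):=\sum_{1\le n\le N}\frac{1}{n\|n\alpha-\gamma\|}\ \le\ C(\log N)^2.$$
   Context: $\|x\|$ denotes the distance from $x\in\mathbb{R}$ to the nearest integer. The sums $S_N(\alpha,\gamma)$ are considered for pairs $(\alpha,\gamma)$ with $\|n\alpha-\gamma\|>0$ for all $n\in\mathbb{N}$ (for fixed $\gamma$ this holds for almost all $\alpha$, and it is understood to hold for $\alpha\in\mathcal{A}_\gamma$). *)

theory Defs
  imports "HOL-Analysis.Analysis"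
begin

text \<open>That \<^term>\<open>round x\<close> is a nearest integer to \<open>x\<close> is \<open>round_diff_minimal\<close>.\<close>

definition dist_nearest_int :: "real \<Rightarrow> real" where
  "dist_nearest_int x = dist x (of_int (round x))"

text \<open>The definition is meaningful only when no \<^term>\<open>dist_nearest_int (real n * \<alpha> - \<gamma>)\<close>
  with \<open>n \<ge> 1\<close> vanishes: such a term would contribute \<open>1 / 0 = 0\<close>.\<close>

definition S :: "nat \<Rightarrow> real \<Rightarrow> real \<Rightarrow> real" where
  "S N \<alpha> \<gamma> = (\<Sum>n = 1..N. 1 / (real n * dist_nearest_int (real n * \<alpha> - \<gamma>)))"

end

theory Submission
  imports Defs "HOL-Real_Asymp.Real_Asymp"
begin


text \<open>
  Write \<open>\<parallel>x\<parallel>\<close> for the distance to the nearest integer and split the range of \<open>n\<close> into the dyadic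
  blocks \<open>2 ^ k \<le> n < 2 ^ Suc k\<close>. Since \<open>ln N\<close> is comparable to the number of blocks below \<open>N\<close>,
  it suffices that block \<open>k\<close> contributes \<open>O(k)\<close>, apart from errors whose sum over \<open>k < m\<close> is
  \<open>O(m\<^sup>2)\<close>.

  The large distances are handled for each \<open>\<alpha>\<close> separately. If \<open>p / q\<close> is a reduced fraction with
  \<open>\<bar>q \<alpha> - p\<bar> \<le> 1 / q\<close>, then \<open>q\<close> consecutive points \<open>n \<alpha> - \<gamma>\<close> are, modulo 1, perturbations by
  \<open>O(1 / q)\<close> of the \<open>q\<close> equally spaced points \<open>r / q\<close>. Hence the reciprocals \<open>1 / \<parallel>n \<alpha> - \<gamma>\<parallel>\<close> that are
  at most \<open>q\<close> add up to \<open>O(q ln q)\<close> over such a window (\<open>sum_far_inverse_window_le\<close>). With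
  \<open>q \<le> 2 ^ k\<close> this gives \<open>O(k)\<close> for the part \<open>\<parallel>n \<alpha> - \<gamma>\<parallel> \<ge> 1 / q\<close> of block \<open>k\<close>.

  The small distances are handled on average over \<open>\<alpha>\<close>. Put \<open>s = gap_exp k\<close>, so that \<open>2 ^ s\<close> is
  about \<open>k\<^sup>2\<close>. By the Borel--Cantelli lemma, almost every \<open>\<alpha>\<close> satisfies
  \<open>\<parallel>n \<alpha> - \<gamma>\<parallel> > 1 / (2 ^ k * 2 ^ s)\<close> on all but finitely many blocks (\<open>AE_eventually_gap\<close>).
  The same fact for \<open>\<gamma> = 0\<close> forces the denominator \<open>q\<close> that Dirichlet's theorem yields for the
  bound \<open>2 ^ k\<close> to be at least \<open>2 ^ k / 2 ^ s\<close> for large \<open>k\<close> (\<open>eventually_good_denominator\<close>).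
  What remains in
  block \<open>k\<close> are the distances between \<open>1 / (2 ^ k * 2 ^ s)\<close> and \<open>2 ^ s / 2 ^ k\<close>. The ratio of these
  endpoints is only a power of \<open>k\<close>, so the mean contribution of the block over a unit interval
  of \<open>\<alpha>\<close> is \<open>O(s) = O(ln k)\<close>. Divided by \<open>k\<^sup>2\<close> these means are summable; so for almost every
  \<open>\<alpha>\<close> the contributions themselves, divided by \<open>k\<^sup>2\<close>, are summable
  (\<open>AE_summable_layer_majorant\<close>), which is exactly what an error of total size \<open>O(m\<^sup>2)\<close> needs.
\<close>

section \<open>Large distances along windows of the orbit\<close>
lemma dist_nearest_int_nonneg: "0 \<le> dist_nearest_int x"
  by (simp add: dist_nearest_int_def)

lemma dist_nearest_int_le: "dist_nearest_int x \<le> \<bar>x - of_int m\<bar>"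
  using round_diff_minimal[of x m] by (simp add: dist_nearest_int_def dist_real_def)


text \<open>The distance from \<open>a / q\<close> to the integers depends only on \<open>a mod q\<close>, and moving the point by
  \<open>\<epsilon>\<close> changes it by at most \<open>\<epsilon>\<close>.\<close>
lemma min_residue_le_dist_nearest_int:
  fixes q :: nat and a :: int and x :: real
  assumes q: "q > 0" and near: "\<bar>x - of_int a / real q\<bar> \<le> \<epsilon>"
    and r: "int r = a mod int q"
  shows "real (min r (q - r)) / real q \<le> dist_nearest_int x + \<epsilon>"
proof -
  define m where "m = round x"
  have rq: "r < q"
    using r q by (metis of_nat_0_less_iff of_nat_less_iff pos_mod_bound)
  obtain t where a: "a = int r + int q * t"
    using r by (metis mod_mult_div_eq)
  have "real (min r (q - r)) \<le> \<bar>real_of_int (a - int q * m)\<bar>"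
  proof (cases "t - m \<ge> 0")
    case True
    then have "int q * (t - m) \<ge> 0" by simp
    then have "int r \<le> a - int q * m" by (simp add: a algebra_simps)
    then have "real r \<le> real_of_int (a - int q * m)" by linarith
    then show ?thesis by linarith
  next
    case False
    then have "int q * (t - m) \<le> int q * (-1)" by (intro mult_left_mono) auto
    then have "int q - int r \<le> - (a - int q * m)" by (simp add: a algebra_simps)
    then have "real q - real r \<le> - real_of_int (a - int q * m)" by linarith
    then show ?thesis using rq by (auto simp: of_nat_diff min_def)
  qed
  then have "real (min r (q - r)) / real q \<le> \<bar>real_of_int (a - int q * m)\<bar> / real q"
    by (simp add: divide_right_mono)
  also have "\<dots> = \<bar>of_int (a - int q * m) / real q\<bar>"
    by simp
  also have "of_int (a - int q * m) / real q = of_int a / real q - of_int m"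
    using q by (simp add: diff_divide_distrib)
  also have "\<bar>of_int a / real q - of_int m\<bar>
      \<le> \<bar>x - of_int m\<bar> + \<bar>x - of_int a / real q\<bar>"
    by linarith
  also have "\<dots> \<le> dist_nearest_int x + \<epsilon>"
    using near by (simp add: dist_nearest_int_def dist_real_def m_def)
  finally show ?thesis .
qed

lemma bij_betw_linear_residues:
  fixes q :: nat and p b :: int
  assumes q: "q > 0" and cop: "coprime p (int q)"
  shows "bij_betw (\<lambda>i. nat ((b + int i * p) mod int q)) {..<q} {..<q}"
proof -
  have "inj_on (\<lambda>i. nat ((b + int i * p) mod int q)) {..<q}"
  proof (rule inj_onI)
    fix i j assume i: "i \<in> {..<q}" and j: "j \<in> {..<q}"
      and eq: "nat ((b + int i * p) mod int q) = nat ((b + int j * p) mod int q)"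
    have "(b + int i * p) mod int q = (b + int j * p) mod int q"
      using eq q by (metis eq_nat_nat_iff of_nat_0_less_iff pos_mod_sign)
    then have "int q dvd (b + int i * p) - (b + int j * p)"
      by (simp add: mod_eq_dvd_iff)
    then have "int q dvd (int i - int j) * p" by (simp add: algebra_simps)
    then have "int q dvd int i - int j"
      using cop by (simp add: coprime_commute coprime_dvd_mult_left_iff)
    then show "i = j" using i j
      by (metis lessThan_iff mod_eq_dvd_iff mod_less of_nat_eq_iff zmod_int)
  qed
  moreover have "(\<lambda>i. nat ((b + int i * p) mod int q)) ` {..<q} \<subseteq> {..<q}"
    using q by (auto simp: nat_less_iff)
  ultimately show ?thesis
    by (simp add: bij_betw_def endo_inj_surj)
qed


text \<open>Let \<open>b / q\<close> be the fraction just below \<open>\<beta>\<close>. Then \<open>\<beta> + i \<alpha>\<close> lies within \<open>2 / q\<close> of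
  \<open>(b + i p) / q\<close>, whose numerators run through every residue class modulo \<open>q\<close> once. So apart
  from the few points near an integer, where the truncation at \<open>1 / q\<close> takes over, the distances
  are bounded below by those of equally spaced points, and the sum is bounded by a harmonic one.\<close>
lemma sum_far_inverse_window_le:
  fixes \<alpha> \<beta> :: real and q :: nat and p :: int
  assumes q: "q > 0" and cop: "coprime p (int q)"
    and approx: "\<bar>real q * \<alpha> - of_int p\<bar> \<le> 1 / real q"
  shows "(\<Sum>i<q. if 1 / real q \<le> dist_nearest_int (\<beta> + real i * \<alpha>)
            then 1 / dist_nearest_int (\<beta> + real i * \<alpha>) else 0) \<le> 8 * real q * harm q"
proof -
  define b where "b = \<lfloor>real q * \<beta>\<rfloor>"
  define r where "r i = nat ((b + int i * p) mod int q)" for i :: nat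
  have r: "bij_betw r {..<q} {..<q}"
    unfolding r_def using bij_betw_linear_residues[OF q cop] .
  have bound: "(if 1 / real q \<le> dist_nearest_int (\<beta> + real i * \<alpha>)
            then 1 / dist_nearest_int (\<beta> + real i * \<alpha>) else 0)
      \<le> 4 * real q * (1 / real (Suc (r i)) + 1 / real (q - r i))"
    (is "?lhs \<le> ?rhs") if i: "i < q" for i
  proof -
    define x where "x = dist_nearest_int (\<beta> + real i * \<alpha>)"
    define d where "d = min (r i) (q - r i)"
    have rq: "r i < q" using r i by (auto simp: bij_betw_def)
    have "\<bar>\<beta> - of_int b / real q\<bar> = \<bar>real q * \<beta> - of_int b\<bar> / real q"
      using q by (simp add: field_simps)
    moreover have "\<bar>real q * \<beta> - of_int b\<bar> \<le> 1"
      unfolding b_def by linarith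
    ultimately have "\<bar>\<beta> - of_int b / real q\<bar> \<le> 1 / real q"
      by (simp add: divide_right_mono)
    moreover have "\<bar>real i * \<alpha> - real i * of_int p / real q\<bar> \<le> 1 / real q"
    proof -
      have "\<bar>real i * \<alpha> - real i * of_int p / real q\<bar>
          = real i / real q * \<bar>real q * \<alpha> - of_int p\<bar>"
      proof -
        have "real i * \<alpha> - real i * of_int p / real q = real i / real q * (real q * \<alpha> - of_int p)"
          using q by (simp add: field_simps)
        then show ?thesis by (simp add: abs_mult)
      qed
      also have "\<dots> \<le> 1 * (1 / real q)"
        using approx i by (intro mult_mono) auto
      finally show ?thesis by simp
    qed
    ultimately have near: "\<bar>\<beta> + real i * \<alpha> - of_int (b + int i * p) / real q\<bar> \<le> 2 / real q"
      by (simp add: add_divide_distrib) (simp add: abs_le_iff field_simps)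
    have "int (r i) = (b + int i * p) mod int q" using q by (simp add: r_def)
    from min_residue_le_dist_nearest_int[OF q near this]
    have d1: "real d / real q \<le> x + 2 / real q" by (simp add: d_def x_def)
    show ?thesis
    proof (cases "1 / real q \<le> x")
      case True
      have "0 < x" using True q by (smt (verit) divide_pos_pos of_nat_0_less_iff)
      have "real d \<le> real q * x + 2" "1 \<le> real q * x"
        using d1 True q by (auto simp: field_simps)
      (* The truncation absorbs the perturbation: the average of the two lower bounds, with
         weights 1/4 and 3/4, already dominates (d + 1) / 4. *)
      then have "real d + 1 \<le> 4 * (real q * x)" by linarith
      then have "1 / x \<le> 4 * real q * (1 / (real d + 1))"
        using \<open>0 < x\<close> by (simp add: divide_simps mult_ac)
      also have "\<dots> \<le> 4 * real q * (1 / real (Suc (r i)) + 1 / real (q - r i))"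
      proof (intro mult_left_mono)
        show "1 / (real d + 1) \<le> 1 / real (Suc (r i)) + 1 / real (q - r i)"
        proof (cases "r i \<le> q - r i")
          case True
          then show ?thesis using rq by (simp add: d_def add.commute)
        next
          case False
          then have "1 / (real d + 1) \<le> 1 / real (q - r i)"
            using rq by (auto simp: d_def intro!: divide_left_mono)
          then show ?thesis by (simp add: add_increasing)
        qed
      qed simp
      finally show ?thesis using True by (simp add: x_def)
    qed (simp add: x_def)
  qed
  have "(\<Sum>i<q. if 1 / real q \<le> dist_nearest_int (\<beta> + real i * \<alpha>)
            then 1 / dist_nearest_int (\<beta> + real i * \<alpha>) else 0)
      \<le> (\<Sum>i<q. 4 * real q * (1 / real (Suc (r i)) + 1 / real (q - r i)))"
    using bound by (intro sum_mono) auto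
  also have "\<dots> = (\<Sum>i<q. 4 * real q * (1 / real (Suc i) + 1 / real (q - i)))"
    using sum.reindex_bij_betw[OF r, of "\<lambda>i. 4 * real q * (1 / real (Suc i) + 1 / real (q - i))"] .
  also have "\<dots> = 4 * real q * ((\<Sum>i<q. 1 / real (Suc i)) + (\<Sum>i<q. 1 / real (q - i)))"
    by (simp add: sum.distrib flip: sum_distrib_left)
  also have "(\<Sum>i<q. 1 / real (q - i)) = (\<Sum>i<q. 1 / real (Suc i))"
    by (subst sum.nat_diff_reindex[symmetric]) (auto intro!: sum.cong)
  also have "(\<Sum>i<q. 1 / real (Suc i)) = harm q"
    by (simp add: harm_altdef inverse_eq_divide)
  finally show ?thesis by simp
qed


text \<open>A range of length \<open>M \<ge> q\<close> is covered by \<open>M div q + 1 \<le> 2 * M / q\<close> windows of length \<open>q\<close>, each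
  with its own starting point \<open>\<beta>\<close>; this is why the window bound has to be uniform in \<open>\<beta>\<close>.\<close>
lemma sum_far_inverse_le:
  fixes \<alpha> \<beta> :: real and q M :: nat and p :: int
  assumes q: "q > 0" and "q \<le> M" and cop: "coprime p (int q)"
    and approx: "\<bar>real q * \<alpha> - of_int p\<bar> \<le> 1 / real q"
  shows "(\<Sum>i<M. if 1 / real q \<le> dist_nearest_int (\<beta> + real i * \<alpha>)
            then 1 / dist_nearest_int (\<beta> + real i * \<alpha>) else 0) \<le> 16 * real M * harm M"
proof -
  define f where "f i = (if 1 / real q \<le> dist_nearest_int (\<beta> + real i * \<alpha>)
            then 1 / dist_nearest_int (\<beta> + real i * \<alpha>) else 0)" for i :: nat
  define w where "w = Suc (M div q)"
  have f0: "0 \<le> f i" for i by (simp add: f_def dist_nearest_int_nonneg)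
  have Mw: "M \<le> w * q"
    using q unfolding w_def by (metis dividend_less_times_div less_imp_le mult.commute mult_Suc_right add.commute)
  have "w * q \<le> 2 * M"
    unfolding w_def using \<open>q \<le> M\<close> by (simp add: mult_2 add_mono)
  then have wq: "real w * real q \<le> 2 * real M"
    by (metis of_nat_le_iff of_nat_mult of_nat_numeral)
  have "sum f {..<M} \<le> sum f {..<w * q}"
    using Mw f0 by (intro sum_mono2) auto
  also have "\<dots> = (\<Sum>m<w. sum f {m * q..<m * q + q})"
    by (rule sum.nat_group[symmetric])
  also have "\<dots> \<le> (\<Sum>m<w. 8 * real q * harm q)"
  proof (intro sum_mono)
    fix m
    have "sum f {m * q..<m * q + q} = (\<Sum>i<q. f (m * q + i))"
      using sum.shift_bounds_nat_ivl[of f 0 "m * q" q] by (simp add: add.commute lessThan_atLeast0)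
    also have "\<dots> \<le> 8 * real q * harm q"
      using sum_far_inverse_window_le[OF q cop approx, of "\<beta> + real (m * q) * \<alpha>"]
      by (simp only: f_def of_nat_add distrib_right add.assoc)
    finally show "sum f {m * q..<m * q + q} \<le> 8 * real q * harm q" .
  qed
  also have "\<dots> = 8 * (real w * real q) * harm q" by simp
  also have "\<dots> \<le> 8 * (2 * real M) * harm M"
    by (rule mult_mono[OF mult_left_mono[OF wq] harm_mono[OF \<open>q \<le> M\<close>]]) (auto simp: harm_nonneg)
  finally show ?thesis by (simp add: f_def)
qed


section \<open>Measure of the set of close approaches\<close>
lemma borel_measurable_dist_nearest_int [measurable]:
  "dist_nearest_int \<in> borel_measurable borel"
proof -
  have "dist_nearest_int = (\<lambda>x. \<bar>x - of_int \<lfloor>x + 1 / 2\<rfloor>\<bar>)"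
    by (auto simp: dist_nearest_int_def dist_real_def round_def)
  moreover have "(\<lambda>x::real. \<bar>x - of_int \<lfloor>x + 1 / 2\<rfloor>\<bar>) \<in> borel_measurable borel"
    by measurable
  ultimately show ?thesis by simp
qed


text \<open>On a unit interval \<open>n \<alpha> - \<gamma>\<close> has at most \<open>n + 1 \<le> 2 * n\<close> nearest integers, and each of them
  is approached within \<open>\<delta>\<close> on an interval of length \<open>2 * \<delta> / n\<close>.\<close>
lemma emeasure_dist_nearest_int_le:
  fixes z \<gamma> \<delta> :: real and n :: nat
  assumes n: "n \<ge> 1" and \<delta>: "\<delta> \<ge> 0"
  shows "emeasure lborel {\<alpha>\<in>{z..z + 1}. dist_nearest_int (real n * \<alpha> - \<gamma>) \<le> \<delta>}
    \<le> ennreal (4 * \<delta>)"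
proof -
  define c where "c = round (real n * z - \<gamma>)"
  define I where "I m = {(of_int m + \<gamma> - \<delta>) / real n..(of_int m + \<gamma> + \<delta>) / real n}" for m :: int
  have "{\<alpha>\<in>{z..z + 1}. dist_nearest_int (real n * \<alpha> - \<gamma>) \<le> \<delta>} \<subseteq> (\<Union>m\<in>{c..c + int n}. I m)"
  proof
    fix \<alpha> assume \<alpha>: "\<alpha> \<in> {\<alpha>\<in>{z..z + 1}. dist_nearest_int (real n * \<alpha> - \<gamma>) \<le> \<delta>}"
    define m where "m = round (real n * \<alpha> - \<gamma>)"
    have "real n * z \<le> real n * \<alpha>" "real n * \<alpha> \<le> real n * (z + 1)"
      using \<alpha> by (auto intro!: mult_left_mono)
    then have "c \<le> m" and "m \<le> c + int n"
      unfolding c_def m_def round_def by (auto simp: algebra_simps intro: floor_mono) linarith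
    moreover have "\<bar>real n * \<alpha> - \<gamma> - of_int m\<bar> \<le> \<delta>"
      using \<alpha> by (simp add: dist_nearest_int_def dist_real_def m_def)
    then have "\<alpha> \<in> I m"
      using n unfolding I_def by (auto simp: field_simps abs_le_iff)
    ultimately show "\<alpha> \<in> (\<Union>m\<in>{c..c + int n}. I m)" by auto
  qed
  then have "emeasure lborel {\<alpha>\<in>{z..z + 1}. dist_nearest_int (real n * \<alpha> - \<gamma>) \<le> \<delta>}
      \<le> emeasure lborel (\<Union>m\<in>{c..c + int n}. I m)"
    by (intro emeasure_mono) (auto simp: I_def)
  also have "\<dots> \<le> (\<Sum>m\<in>{c..c + int n}. emeasure lborel (I m))"
    by (intro emeasure_subadditive_finite) (auto simp: I_def)
  also have "\<dots> = (\<Sum>m\<in>{c..c + int n}. ennreal (2 * \<delta> / real n))"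
  proof (intro sum.cong refl)
    fix m
    have "(of_int m + \<gamma> - \<delta>) / real n \<le> (of_int m + \<gamma> + \<delta>) / real n"
      using \<delta> by (intro divide_right_mono) auto
    then show "emeasure lborel (I m) = ennreal (2 * \<delta> / real n)"
      by (simp add: I_def flip: diff_divide_distrib)
  qed
  also have "\<dots> = ennreal (real (n + 1) * (2 * \<delta> / real n))"
    using \<delta> by (subst sum_ennreal) (auto simp: nat_add_distrib)
  also have "real (n + 1) * (2 * \<delta> / real n) \<le> (2 * real n) * (2 * \<delta> / real n)"
    using n \<delta> by (intro mult_right_mono) auto
  then have "ennreal (real (n + 1) * (2 * \<delta> / real n)) \<le> ennreal (4 * \<delta>)"
    using n by (intro ennreal_leI) auto
  finally show ?thesis .
qed


text \<open>The measure and integral bounds are finite only on bounded sets of \<open>\<alpha>\<close>, so almost-sure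
  statements are proved on unit intervals.\<close>
lemma AE_lborel_if_unit_intervals:
  assumes "\<And>z::int. AE \<alpha> in lborel. \<alpha> \<in> {of_int z..of_int z + 1} \<longrightarrow> P \<alpha>"
  shows "AE \<alpha> in lborel. P (\<alpha> :: real)"
proof -
  have "AE \<alpha> in lborel. \<forall>z::int. \<alpha> \<in> {of_int z..of_int z + 1} \<longrightarrow> P \<alpha>"
    by (intro iffD2[OF AE_all_countable] allI assms)
  then show ?thesis
  proof (rule AE_mp, intro AE_I2 impI)
    fix \<alpha> :: real
    assume *: "\<forall>z::int. \<alpha> \<in> {of_int z..of_int z + 1} \<longrightarrow> P \<alpha>"
    have "\<alpha> \<in> {of_int \<lfloor>\<alpha>\<rfloor>..of_int \<lfloor>\<alpha>\<rfloor> + 1}" by simp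
    then show "P \<alpha>" using * by blast
  qed
qed

lemma AE_dist_nearest_int_pos:
  fixes \<gamma> :: real
  shows "AE \<alpha> in lborel. \<forall>n\<ge>1. 0 < dist_nearest_int (real n * \<alpha> - \<gamma>)"
proof (rule AE_lborel_if_unit_intervals)
  fix z :: int
  have "AE \<alpha> in lborel. n \<ge> 1 \<longrightarrow> \<alpha> \<in> {of_int z..of_int z + 1} \<longrightarrow>
      0 < dist_nearest_int (real n * \<alpha> - \<gamma>)" for n :: nat
  proof (cases "n \<ge> 1")
    case True
    let ?A = "{\<alpha>\<in>{of_int z..of_int z + 1}. dist_nearest_int (real n * \<alpha> - \<gamma>) \<le> 0}"
    have "?A \<in> null_sets lborel"
      using emeasure_dist_nearest_int_le[OF True, of 0 "of_int z" \<gamma>] by (intro null_setsI) auto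
    from AE_not_in[OF this] show ?thesis by eventually_elim (auto simp: not_le)
  qed simp
  then have "AE \<alpha> in lborel. \<forall>n::nat. n \<ge> 1 \<longrightarrow> \<alpha> \<in> {of_int z..of_int z + 1} \<longrightarrow>
      0 < dist_nearest_int (real n * \<alpha> - \<gamma>)"
    by (intro iffD2[OF AE_all_countable] allI)
  then show "AE \<alpha> in lborel. \<alpha> \<in> {of_int z..of_int z + 1} \<longrightarrow>
      (\<forall>n\<ge>1. 0 < dist_nearest_int (real n * \<alpha> - \<gamma>))"
    by eventually_elim auto
qed


section \<open>Almost every orbit avoids very close approaches\<close>

text \<open>The power \<open>2 ^ gap_exp k\<close> has to grow fast enough for its reciprocals to be summable (the
  Borel--Cantelli argument), and its exponent slowly enough for \<open>gap_exp k / k\<^sup>2\<close> to be summable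
  (the mean value argument). Rounding \<open>(k + 1)\<^sup>2\<close> up to a power of two does both, and keeps the
  thresholds compatible with a decomposition into dyadic layers.\<close>
definition gap_exp :: "nat \<Rightarrow> nat" where
  "gap_exp k = nat \<lceil>2 * log 2 (real (Suc k))\<rceil>"

lemma square_Suc_le_two_power_gap_exp: "(real (Suc k))\<^sup>2 \<le> 2 ^ gap_exp k"
proof -
  have "(real (Suc k))\<^sup>2 = 2 powr (2 * log 2 (real (Suc k)))"
    by (simp add: powr_powr[symmetric] mult.commute[of 2] powr_realpow)
  also have "\<dots> \<le> 2 powr real (gap_exp k)"
    unfolding gap_exp_def by (intro powr_mono) linarith+
  finally show ?thesis by (simp add: powr_realpow)
qed

lemma gap_exp_mono: "k \<le> l \<Longrightarrow> gap_exp k \<le> gap_exp l"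
  unfolding gap_exp_def by (intro nat_mono ceiling_mono mult_left_mono) auto

lemma gap_exp_le: "real (gap_exp k) \<le> 2 * log 2 (real (Suc k)) + 1"
proof -
  have "0 \<le> log 2 (real (Suc k))" by simp
  then show ?thesis unfolding gap_exp_def by linarith
qed

lemma summable_inverse_square_Suc: "summable (\<lambda>k. 1 / (real (Suc k))\<^sup>2)"
  using summable_Suc_iff[of "\<lambda>k. 1 / (real k)\<^sup>2"] inverse_power_summable[of 2, where ?'a=real]
  by (simp add: inverse_eq_divide)

lemma summable_gap_exp_over_square: "summable (\<lambda>k. (2 * real (gap_exp k) + 1) / (real (Suc k))\<^sup>2)"
proof -
  have "(\<lambda>k::nat. (4 * log 2 (real (Suc k)) + 3) / (real (Suc k))\<^sup>2) \<in> O(\<lambda>k. real k powr (-3/2))"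
    by real_asymp
  moreover have "summable (\<lambda>k. norm (real k powr (-3/2)))"
    by (simp add: summable_real_powr_iff)
  ultimately have "summable (\<lambda>k::nat. (4 * log 2 (real (Suc k)) + 3) / (real (Suc k))\<^sup>2)"
    by (rule summable_comparison_test_bigo[rotated])
  then show ?thesis
  proof (rule summable_comparison_test')
    fix k :: nat
    show "norm ((2 * real (gap_exp k) + 1) / (real (Suc k))\<^sup>2)
        \<le> (4 * log 2 (real (Suc k)) + 3) / (real (Suc k))\<^sup>2"
      using gap_exp_le[of k] by (simp add: divide_right_mono)
  qed
qed


text \<open>Block \<open>k\<close> has \<open>2 ^ k\<close> members, and each violates the bound on a subset of a unit
  interval of measure at most
  \<open>4 / (2 ^ k * 2 ^ gap_exp k)\<close>. The total \<open>4 / 2 ^ gap_exp k\<close> is summable over \<open>k\<close>.\<close>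
lemma AE_eventually_gap:
  fixes \<gamma> :: real
  shows "AE \<alpha> in lborel. \<forall>\<^sub>F k in sequentially. \<forall>n\<in>{2 ^ k..<2 ^ Suc k}.
    1 / (2 ^ k * 2 ^ gap_exp k) < dist_nearest_int (real n * \<alpha> - \<gamma>)"
proof (rule AE_lborel_if_unit_intervals)
  fix z :: int
  define \<psi> :: "nat \<Rightarrow> real" where "\<psi> k = 1 / (2 ^ k * 2 ^ gap_exp k)" for k
  define B where
    "B k n = {\<alpha>\<in>{of_int z..of_int z + 1}. dist_nearest_int (real n * \<alpha> - \<gamma>) \<le> \<psi> k}" for k n
  define E where "E k = (\<Union>n\<in>{2 ^ k..<2 ^ Suc k}. B k n)" for k :: nat
  have [measurable]: "B k n \<in> sets borel" for k n unfolding B_def by measurable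
  have E_meas: "E k \<in> sets lborel" for k unfolding E_def by auto
  have bound: "emeasure lborel (E k) \<le> ennreal (4 * (1 / (real (Suc k))\<^sup>2))" for k
  proof -
    have "emeasure lborel (E k) \<le> (\<Sum>n\<in>{2 ^ k..<2 ^ Suc k}. emeasure lborel (B k n))"
      unfolding E_def by (intro emeasure_subadditive_finite) auto
    also have "\<dots> \<le> (\<Sum>n\<in>{2 ^ k..<2 ^ Suc k::nat}. ennreal (4 * \<psi> k))"
    proof (intro sum_mono)
      fix n :: nat assume "n \<in> {2 ^ k..<2 ^ Suc k}"
      then have "1 \<le> n" using one_le_power[of "2::nat" k] by (simp del: one_le_power)
      then show "emeasure lborel (B k n) \<le> ennreal (4 * \<psi> k)"
        unfolding B_def by (rule emeasure_dist_nearest_int_le) (simp add: \<psi>_def)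
    qed
    also have "\<dots> = ennreal (2 ^ k * (4 * \<psi> k))"
      by (subst sum_ennreal) (auto simp: \<psi>_def)
    also have "\<dots> \<le> ennreal (4 * (1 / (real (Suc k))\<^sup>2))"
      using square_Suc_le_two_power_gap_exp[of k]
      by (intro ennreal_leI) (auto simp: \<psi>_def intro!: divide_left_mono)
    finally show ?thesis .
  qed
  have "summable (\<lambda>k. 4 * (1 / (real (Suc k))\<^sup>2))"
    by (intro summable_mult summable_inverse_square_Suc)
  then have "summable (\<lambda>k. measure lborel (E k))"
  proof (rule summable_comparison_test')
    fix k :: nat
    show "norm (measure lborel (E k)) \<le> 4 * (1 / (real (Suc k))\<^sup>2)"
      using bound[of k] by (auto simp: measure_def intro!: enn2real_leI)
  qed
  moreover have "emeasure lborel (E k) < \<infinity>" for k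
    using bound[of k] by (simp add: order_le_less_trans[OF _ ennreal_less_top])
  ultimately have "AE \<alpha> in lborel. \<forall>\<^sub>F k in sequentially. \<alpha> \<in> space lborel - E k"
    using E_meas by (intro borel_cantelli_AE1)
  then show "AE \<alpha> in lborel. \<alpha> \<in> {of_int z..of_int z + 1} \<longrightarrow>
    (\<forall>\<^sub>F k in sequentially. \<forall>n\<in>{2 ^ k..<2 ^ Suc k}.
      1 / (2 ^ k * 2 ^ gap_exp k) < dist_nearest_int (real n * \<alpha> - \<gamma>))"
  proof (rule AE_mp, intro AE_I2 impI)
    fix \<alpha> :: real
    assume ev: "\<forall>\<^sub>F k in sequentially. \<alpha> \<in> space lborel - E k"
      and "\<alpha> \<in> {of_int z..of_int z + 1}"
    then show "\<forall>\<^sub>F k in sequentially. \<forall>n\<in>{2 ^ k..<2 ^ Suc k}.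
      1 / (2 ^ k * 2 ^ gap_exp k) < dist_nearest_int (real n * \<alpha> - \<gamma>)"
      by (auto elim!: eventually_mono simp: E_def B_def \<psi>_def not_le)
  qed
qed


section \<open>Small distances on average\<close>

text \<open>A step function that dominates \<open>1 / x\<close> for \<open>\<phi> / 2 ^ J \<le> x \<le> \<phi>\<close>. In place of the integral of
  \<open>1 / x\<close>, its mean over \<open>\<alpha>\<close> at \<open>x = \<parallel>n \<alpha> - \<gamma>\<parallel>\<close> needs only the measures of the sets where \<open>x\<close> is below a threshold; every layer
  has mean \<open>O(1)\<close>, so that their number takes the role of the logarithm of the ratio of the
  endpoints.\<close>
definition layer_majorant :: "real \<Rightarrow> nat \<Rightarrow> real \<Rightarrow> real" where
  "layer_majorant \<phi> J x = (\<Sum>j\<le>J. if x \<le> \<phi> / 2 ^ j then 2 ^ Suc j / \<phi> else 0)"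

lemma layer_majorant_nonneg: "0 < \<phi> \<Longrightarrow> 0 \<le> layer_majorant \<phi> J x"
  unfolding layer_majorant_def by (intro sum_nonneg) auto

lemma borel_measurable_layer_majorant [measurable]:
  "layer_majorant \<phi> J \<in> borel_measurable borel"
  unfolding layer_majorant_def[abs_def] by measurable


text \<open>The last layer that still contains \<open>x\<close> suffices: its threshold exceeds \<open>x\<close> by a factor of at
  most 2.\<close>
lemma inverse_le_layer_majorant:
  assumes \<phi>: "0 < \<phi>" and x: "\<phi> / 2 ^ J \<le> x" "x \<le> \<phi>"
  shows "1 / x \<le> layer_majorant \<phi> J x"
proof -
  define i where "i = (GREATEST j. j \<le> J \<and> x \<le> \<phi> / 2 ^ j)"
  have i: "i \<le> J \<and> x \<le> \<phi> / 2 ^ i"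
    unfolding i_def by (rule GreatestI_nat[of _ 0 J]) (use x in auto)
  have lower: "\<phi> / 2 ^ Suc i \<le> x"
  proof (cases "i = J")
    case True
    have "\<phi> / 2 ^ Suc J \<le> \<phi> / 2 ^ J" using \<phi> by (simp add: field_simps)
    with True x show ?thesis by simp
  next
    case False
    then show ?thesis
      using Greatest_le_nat[of "\<lambda>j. j \<le> J \<and> x \<le> \<phi> / 2 ^ j" "Suc i" J] i
      by (fastforce simp: i_def[symmetric])
  qed
  have "0 < x" using lower \<phi> by (smt (verit) divide_pos_pos zero_less_power)
  then have "1 / x \<le> 2 ^ Suc i / \<phi>"
    using lower \<phi> by (simp add: field_simps)
  also have "\<dots> \<le> layer_majorant \<phi> J x"
    unfolding layer_majorant_def
    using i \<phi> member_le_sum[of i "{..J}" "\<lambda>j. if x \<le> \<phi> / 2 ^ j then 2 ^ Suc j / \<phi> else 0"]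
    by auto
  finally show ?thesis .
qed

lemma nn_integral_layer_majorant_le:
  fixes z \<gamma> \<phi> :: real and n J :: nat
  assumes n: "n \<ge> 1" and \<phi>: "0 < \<phi>"
  shows "(\<integral>\<^sup>+\<alpha>. ennreal (layer_majorant \<phi> J (dist_nearest_int (real n * \<alpha> - \<gamma>)))
      * indicator {z..z + 1} \<alpha> \<partial>lborel) \<le> ennreal (8 * (real J + 1))"
proof -
  define B where "B j = {\<alpha>\<in>{z..z + 1}. dist_nearest_int (real n * \<alpha> - \<gamma>) \<le> \<phi> / 2 ^ j}" for j
  have [measurable]: "B j \<in> sets borel" for j unfolding B_def by measurable
  have "ennreal (layer_majorant \<phi> J (dist_nearest_int (real n * \<alpha> - \<gamma>))) * indicator {z..z + 1} \<alpha>
      = (\<Sum>j\<le>J. ennreal (2 ^ Suc j / \<phi>) * indicator (B j) \<alpha>)" for \<alpha>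
  proof (cases "\<alpha> \<in> {z..z + 1}")
    case True
    then have "layer_majorant \<phi> J (dist_nearest_int (real n * \<alpha> - \<gamma>))
        = (\<Sum>j\<le>J. (2 ^ Suc j / \<phi>) * indicator (B j) \<alpha>)"
      unfolding layer_majorant_def by (intro sum.cong) (auto simp: B_def)
    also have "ennreal \<dots> = (\<Sum>j\<le>J. ennreal ((2 ^ Suc j / \<phi>) * indicator (B j) \<alpha>))"
      using \<phi> by (intro sum_ennreal[symmetric]) auto
    also have "\<dots> = (\<Sum>j\<le>J. ennreal (2 ^ Suc j / \<phi>) * indicator (B j) \<alpha>)"
      by (intro sum.cong) (auto simp: indicator_def)
    finally show ?thesis using True by simp
  qed (auto simp: B_def)
  then have "(\<integral>\<^sup>+\<alpha>. ennreal (layer_majorant \<phi> J (dist_nearest_int (real n * \<alpha> - \<gamma>)))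
        * indicator {z..z + 1} \<alpha> \<partial>lborel)
      = (\<integral>\<^sup>+\<alpha>. (\<Sum>j\<le>J. ennreal (2 ^ Suc j / \<phi>) * indicator (B j) \<alpha>) \<partial>lborel)"
    by simp
  also have "\<dots> = (\<Sum>j\<le>J. ennreal (2 ^ Suc j / \<phi>) * emeasure lborel (B j))"
    by (subst nn_integral_sum) (auto simp: nn_integral_cmult_indicator)
  also have "\<dots> \<le> (\<Sum>j\<le>J. ennreal 8)"
  proof (intro sum_mono)
    fix j
    have "ennreal (2 ^ Suc j / \<phi>) * emeasure lborel (B j)
        \<le> ennreal (2 ^ Suc j / \<phi>) * ennreal (4 * (\<phi> / 2 ^ j))"
      unfolding B_def using n \<phi> by (intro mult_left_mono emeasure_dist_nearest_int_le) auto
    also have "\<dots> = ennreal 8"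
      using \<phi> by (simp add: field_simps flip: ennreal_mult)
    finally show "ennreal (2 ^ Suc j / \<phi>) * emeasure lborel (B j) \<le> ennreal 8" .
  qed
  also have "\<dots> = ennreal (8 * (real J + 1))"
    by (subst sum_ennreal) (auto simp: algebra_simps)
  finally show ?thesis .
qed


text \<open>The series has a finite integral over every unit interval, because its \<open>k\<close>-th term has mean
  \<open>O(gap_exp k / k\<^sup>2)\<close>. The \<open>2 * gap_exp k\<close> layers below \<open>2 ^ gap_exp k / 2 ^ k\<close> reach down to
  \<open>1 / (2 ^ k * 2 ^ gap_exp k)\<close>, the distance that \<open>AE_eventually_gap\<close> guarantees.\<close>
lemma AE_summable_layer_majorant:
  fixes \<gamma> :: real
  shows "AE \<alpha> in lborel. summable (\<lambda>k.
    (\<Sum>n\<in>{2 ^ k..<2 ^ Suc k}. layer_majorant (2 ^ gap_exp k / 2 ^ k) (2 * gap_exp k)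
        (dist_nearest_int (real n * \<alpha> - \<gamma>))) / 2 ^ k / (real (Suc k))\<^sup>2)"
proof (rule AE_lborel_if_unit_intervals)
  fix z :: int
  define h where "h k n \<alpha> = layer_majorant (2 ^ gap_exp k / 2 ^ k) (2 * gap_exp k)
        (dist_nearest_int (real n * \<alpha> - \<gamma>))" for k n :: nat and \<alpha> :: real
  define G where "G k \<alpha> = (\<Sum>n\<in>{2 ^ k..<2 ^ Suc k}. h k n \<alpha>) / 2 ^ k / (real (Suc k))\<^sup>2"
    for k :: nat and \<alpha>
  have h0: "0 \<le> h k n \<alpha>" for k n \<alpha>
    by (simp add: h_def layer_majorant_nonneg)
  have G0: "0 \<le> G k \<alpha>" for k \<alpha> by (simp add: G_def sum_nonneg h0)
  have [measurable]: "h k n \<in> borel_measurable borel" for k n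
    unfolding h_def[abs_def] by measurable
  have [measurable]: "G k \<in> borel_measurable borel" for k
    unfolding G_def[abs_def] by measurable
  let ?U = "{of_int z..of_int z + 1 :: real}"
  have int_G: "(\<integral>\<^sup>+\<alpha>. ennreal (G k \<alpha>) * indicator ?U \<alpha> \<partial>lborel)
      \<le> ennreal (8 * ((2 * real (gap_exp k) + 1) / (real (Suc k))\<^sup>2))" for k
  proof -
    define c where "c = 1 / 2 ^ k / (real (Suc k))\<^sup>2"
    have c: "0 \<le> c" by (simp add: c_def)
    have "G k \<alpha> = (\<Sum>n\<in>{2 ^ k..<2 ^ Suc k}. c * h k n \<alpha>)" for \<alpha>
      by (simp add: G_def c_def sum_divide_distrib)
    then have "ennreal (G k \<alpha>) = (\<Sum>n\<in>{2 ^ k..<2 ^ Suc k}. ennreal c * ennreal (h k n \<alpha>))" for \<alpha>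
      using c h0 by (simp only: ennreal_mult sum_ennreal[symmetric] mult_nonneg_nonneg)
    then have "(\<integral>\<^sup>+\<alpha>. ennreal (G k \<alpha>) * indicator ?U \<alpha> \<partial>lborel)
      = (\<integral>\<^sup>+\<alpha>. (\<Sum>n\<in>{2 ^ k..<2 ^ Suc k}. ennreal c * (ennreal (h k n \<alpha>) * indicator ?U \<alpha>)) \<partial>lborel)"
      by (simp only: sum_distrib_right mult.assoc)
    also have "\<dots> = (\<Sum>n\<in>{2 ^ k..<2 ^ Suc k}.
        ennreal c * (\<integral>\<^sup>+\<alpha>. ennreal (h k n \<alpha>) * indicator ?U \<alpha> \<partial>lborel))"
      by (subst nn_integral_sum) (auto simp: nn_integral_cmult)
    also have "\<dots> \<le> (\<Sum>n\<in>{2 ^ k..<2 ^ Suc k::nat}.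
        ennreal c * ennreal (8 * (real (2 * gap_exp k) + 1)))"
    proof (intro sum_mono mult_left_mono)
      fix n :: nat assume "n \<in> {2 ^ k..<2 ^ Suc k}"
      then have "1 \<le> n" using one_le_power[of "2::nat" k] by (simp del: one_le_power)
      then show "(\<integral>\<^sup>+\<alpha>. ennreal (h k n \<alpha>) * indicator ?U \<alpha> \<partial>lborel)
          \<le> ennreal (8 * (real (2 * gap_exp k) + 1))"
        unfolding h_def by (rule nn_integral_layer_majorant_le) simp
    qed simp
    also have "\<dots> = (\<Sum>n\<in>{2 ^ k..<2 ^ Suc k::nat}. ennreal (c * (8 * (real (2 * gap_exp k) + 1))))"
      using c by (simp add: ennreal_mult)
    also have "\<dots> = ennreal (8 * ((2 * real (gap_exp k) + 1) / (real (Suc k))\<^sup>2))"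
      using c by (subst sum_ennreal) (auto simp: c_def)
    finally show ?thesis .
  qed
  have "(\<integral>\<^sup>+\<alpha>. (\<Sum>k. ennreal (G k \<alpha>) * indicator ?U \<alpha>) \<partial>lborel)
      = (\<Sum>k. \<integral>\<^sup>+\<alpha>. ennreal (G k \<alpha>) * indicator ?U \<alpha> \<partial>lborel)"
    by (intro nn_integral_suminf) measurable
  also have "\<dots> \<le> (\<Sum>k. ennreal (8 * ((2 * real (gap_exp k) + 1) / (real (Suc k))\<^sup>2)))"
    by (intro suminf_le int_G summableI)
  also have "\<dots> < \<infinity>"
  proof -
    have "summable (\<lambda>k. 8 * ((2 * real (gap_exp k) + 1) / (real (Suc k))\<^sup>2))"
      by (intro summable_mult summable_gap_exp_over_square)
    then have "(\<Sum>k. ennreal (8 * ((2 * real (gap_exp k) + 1) / (real (Suc k))\<^sup>2))) \<noteq> top"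
      by (rule ennreal_suminf_neq_top) simp
    then show ?thesis unfolding infinity_ennreal_def by (rule iffD1[OF less_top])
  qed
  finally have "AE \<alpha> in lborel. (\<Sum>k. ennreal (G k \<alpha>) * indicator ?U \<alpha>) \<noteq> \<infinity>"
    by (intro nn_integral_PInf_AE) auto
  then have "AE \<alpha> in lborel. \<alpha> \<in> ?U \<longrightarrow> summable (\<lambda>k. G k \<alpha>)"
  proof (rule AE_mp, intro AE_I2 impI)
    fix \<alpha> assume "(\<Sum>k. ennreal (G k \<alpha>) * indicator ?U \<alpha>) \<noteq> \<infinity>" "\<alpha> \<in> ?U"
    then show "summable (\<lambda>k. G k \<alpha>)"
      using G0 by (intro summable_suminf_not_top) auto
  qed
  then show "AE \<alpha> in lborel. \<alpha> \<in> ?U \<longrightarrow> summable (\<lambda>k.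
    (\<Sum>n\<in>{2 ^ k..<2 ^ Suc k}. layer_majorant (2 ^ gap_exp k / 2 ^ k) (2 * gap_exp k)
        (dist_nearest_int (real n * \<alpha> - \<gamma>))) / 2 ^ k / (real (Suc k))\<^sup>2)"
    by (simp add: G_def h_def)
qed

section \<open>Dyadic blocks\<close>

text \<open>If the denominator \<open>q\<close> obtained from Dirichlet's theorem lies in block \<open>k'\<close>, the gap condition
  at \<open>q\<close> itself reads \<open>1 / (2 ^ k' * 2 ^ gap_exp k') < \<parallel>q \<alpha>\<parallel> < 1 / 2 ^ k\<close>, so \<open>q\<close> cannot be much
  smaller than \<open>2 ^ k\<close>. The finitely many blocks on which the gap condition may fail contain no
  such \<open>q\<close> once \<open>1 / 2 ^ k\<close> is below the least \<open>\<parallel>n \<alpha>\<parallel>\<close> that occurs there.\<close>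
lemma eventually_good_denominator:
  fixes \<alpha> :: real
  assumes pos: "\<And>n. n \<ge> 1 \<Longrightarrow> 0 < dist_nearest_int (real n * \<alpha>)"
    and gap: "\<forall>\<^sub>F k in sequentially. \<forall>n\<in>{2 ^ k..<2 ^ Suc k}.
      1 / (2 ^ k * 2 ^ gap_exp k) < dist_nearest_int (real n * \<alpha>)"
  shows "\<forall>\<^sub>F k in sequentially. \<exists>(q::nat) (p::int). 0 < q \<and> q \<le> 2 ^ k \<and> coprime p (int q) \<and>
    \<bar>real q * \<alpha> - of_int p\<bar> < 1 / 2 ^ k \<and> 2 ^ k \<le> real q * 2 ^ gap_exp k"
proof -
  obtain K where K: "\<And>k n. k \<ge> K \<Longrightarrow> n \<in> {2 ^ k..<2 ^ Suc k} \<Longrightarrow>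
      1 / (2 ^ k * 2 ^ gap_exp k) < dist_nearest_int (real n * \<alpha>)"
    using gap unfolding eventually_sequentially by blast
  define \<delta> where "\<delta> = Min ((\<lambda>n. dist_nearest_int (real n * \<alpha>)) ` {1..2 ^ K})"
  have \<delta>: "0 < \<delta>" unfolding \<delta>_def using pos by (subst Min_gr_iff) auto
  have \<delta>_le: "\<delta> \<le> dist_nearest_int (real n * \<alpha>)" if "1 \<le> n" "n \<le> 2 ^ K" for n
    unfolding \<delta>_def using that by (intro Min_le) auto
  have "(\<lambda>k. 1 / 2 ^ k :: real) \<longlonglongrightarrow> 0" by real_asymp
  from order_tendstoD(2)[OF this \<delta>] show ?thesis
  proof eventually_elim
    fix k :: nat assume k: "1 / 2 ^ k < \<delta>"
    obtain p q' where cop: "coprime p q'" and q': "0 < q'" "q' \<le> int (2 ^ k)"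
      and approx: "\<bar>of_int q' * \<alpha> - of_int p\<bar> < 1 / real (2 ^ k)"
      using Dirichlet_approx_coprime[of "2 ^ k" \<alpha>] by auto
    define q where "q = nat q'"
    have q'_eq: "q' = int q" using q' by (simp add: q_def)
    have q: "0 < q" "q \<le> 2 ^ k" using q' by (auto simp: q_def nat_le_iff)
    have approx': "\<bar>real q * \<alpha> - of_int p\<bar> < 1 / 2 ^ k" using approx by (simp add: q'_eq)
    then have small: "dist_nearest_int (real q * \<alpha>) < 1 / 2 ^ k"
      using dist_nearest_int_le[of "real q * \<alpha>" p] by linarith
    have "2 ^ K < q"
    proof (rule ccontr)
      assume "\<not> 2 ^ K < q"
      then show False using \<delta>_le[of q] q small k by auto
    qed
    obtain k' where k': "2 ^ k' \<le> q" "q < 2 ^ Suc k'"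
      using ex_power_ivl1[of 2 q] q by auto
    have "(2::nat) ^ K < 2 ^ Suc k'" "(2::nat) ^ k' \<le> 2 ^ k"
      using k' q \<open>2 ^ K < q\<close> by linarith+
    then have "K \<le> k'" "k' \<le> k"
      by (simp_all add: power_strict_increasing_iff less_Suc_eq_le del: power_Suc)
    have "1 / (2 ^ k' * 2 ^ gap_exp k') < 1 / (2 ^ k :: real)"
      using K[OF \<open>K \<le> k'\<close>, of q] k' small by (auto intro: less_trans)
    then have "2 ^ k < 2 ^ k' * (2 ^ gap_exp k' :: real)"
      by (simp add: divide_simps)
    also have "\<dots> \<le> real q * 2 ^ gap_exp k"
      using k' \<open>k' \<le> k\<close> by (intro mult_mono power_increasing gap_exp_mono) auto
    finally show "\<exists>(q::nat) (p::int). 0 < q \<and> q \<le> 2 ^ k \<and> coprime p (int q) \<and>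
      \<bar>real q * \<alpha> - of_int p\<bar> < 1 / 2 ^ k \<and> 2 ^ k \<le> real q * 2 ^ gap_exp k"
      using q cop approx' unfolding q'_eq by (intro exI[of _ q] exI[of _ p]) auto
  qed
qed

lemma harm_two_power_le: "harm (2 ^ k) \<le> real (Suc k)"
proof -
  have "harm (2 ^ k) - ln (real (2 ^ k)) \<le> harm 1 - ln (real 1)"
    by (rule euler_mascheroni_sequence_decreasing) auto
  then have "harm (2 ^ k) \<le> 1 + real k * ln 2"
    by (simp add: harm_expand ln_realpow)
  also have "\<dots> \<le> 1 + real k * 1"
    using ln_2_less_1 by (intro add_left_mono mult_left_mono) auto
  finally show ?thesis by simp
qed


text \<open>The distances split at \<open>1 / q\<close>. Those above are covered by the window estimate. Those below
  lie in the range of the layer majorant: the gap condition bounds them from below, and the lower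
  bound on \<open>q\<close> gives \<open>1 / q \<le> 2 ^ gap_exp k / 2 ^ k\<close>.\<close>
lemma sum_dyadic_block_le:
  fixes \<alpha> \<gamma> :: real and k q :: nat and p :: int
  assumes q: "0 < q" "q \<le> 2 ^ k" "coprime p (int q)"
    and approx: "\<bar>real q * \<alpha> - of_int p\<bar> < 1 / 2 ^ k"
    and large: "2 ^ k \<le> real q * 2 ^ gap_exp k"
    and gap: "\<And>n. n \<in> {2 ^ k..<2 ^ Suc k} \<Longrightarrow>
      1 / (2 ^ k * 2 ^ gap_exp k) < dist_nearest_int (real n * \<alpha> - \<gamma>)"
  shows "(\<Sum>n\<in>{2 ^ k..<2 ^ Suc k}. 1 / (real n * dist_nearest_int (real n * \<alpha> - \<gamma>)))
    \<le> 16 * real (Suc k) + (\<Sum>n\<in>{2 ^ k..<2 ^ Suc k}.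
        layer_majorant (2 ^ gap_exp k / 2 ^ k) (2 * gap_exp k)
          (dist_nearest_int (real n * \<alpha> - \<gamma>))) / 2 ^ k"
proof -
  define x where "x n = dist_nearest_int (real n * \<alpha> - \<gamma>)" for n :: nat
  define far where "far y = (if 1 / real q \<le> y then 1 / y else 0)" for y :: real
  define h where "h = layer_majorant (2 ^ gap_exp k / 2 ^ k) (2 * gap_exp k)"
  have h0: "0 \<le> h y" for y by (simp add: h_def layer_majorant_nonneg)
  have term_le: "1 / (real n * x n) \<le> (far (x n) + h (x n)) / 2 ^ k"
    if n: "n \<in> {2 ^ k..<2 ^ Suc k}" for n
  proof -
    have gap': "1 / (2 ^ k * 2 ^ gap_exp k) < x n" using gap[OF n] by (simp add: x_def)
    then have x0: "0 < x n" by (smt (verit) divide_pos_pos mult_pos_pos zero_less_power)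
    have "real (2 ^ k) \<le> real n" using n by (simp only: of_nat_le_iff) auto
    then have "1 / (real n * x n) \<le> 1 / (2 ^ k * x n)"
      using x0 by (intro divide_left_mono mult_right_mono mult_pos_pos) (auto intro: less_le_trans[rotated])
    also have "\<dots> = (1 / x n) / 2 ^ k" by simp
    also have "1 / x n \<le> far (x n) + h (x n)"
    proof (cases "1 / real q \<le> x n")
      case True
      then show ?thesis using h0 by (simp add: far_def)
    next
      case False
      have "1 / real q \<le> 2 ^ gap_exp k / 2 ^ k"
        using large q by (simp add: field_simps)
      with False have "x n \<le> 2 ^ gap_exp k / 2 ^ k" by linarith
      moreover have "2 ^ gap_exp k / 2 ^ k / 2 ^ (2 * gap_exp k) \<le> x n"
        using gap' by (simp add: mult_2 power_add)
      ultimately have "1 / x n \<le> h (x n)"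
        unfolding h_def by (intro inverse_le_layer_majorant) auto
      then show ?thesis using False by (simp add: far_def)
    qed
    finally show ?thesis by (simp add: divide_right_mono)
  qed
  have "\<bar>real q * \<alpha> - of_int p\<bar> \<le> 1 / real q"
  proof -
    have "real q \<le> 2 ^ k" using q(2) by (metis of_nat_le_iff of_nat_numeral of_nat_power)
    then have "1 / 2 ^ k \<le> 1 / real q" using q(1) by (intro divide_left_mono) auto
    then show ?thesis using approx by linarith
  qed
  then have "(\<Sum>i<2 ^ k. far (dist_nearest_int (real (2 ^ k) * \<alpha> - \<gamma> + real i * \<alpha>)))
      \<le> 16 * real (2 ^ k) * harm (2 ^ k)"
    unfolding far_def by (intro sum_far_inverse_le[OF q])
  moreover have "(\<Sum>n\<in>{2 ^ k..<2 ^ Suc k}. far (x n))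
      = (\<Sum>i<2 ^ k. far (dist_nearest_int (real (2 ^ k) * \<alpha> - \<gamma> + real i * \<alpha>)))"
    using sum.shift_bounds_nat_ivl[of "\<lambda>n. far (x n)" 0 "2 ^ k" "2 ^ k"]
    by (simp add: x_def lessThan_atLeast0 mult_2 algebra_simps)
  ultimately have "(\<Sum>n\<in>{2 ^ k..<2 ^ Suc k}. far (x n)) \<le> 16 * real (2 ^ k) * harm (2 ^ k)"
    by simp
  also have "\<dots> \<le> 16 * real (2 ^ k) * real (Suc k)"
    by (intro mult_left_mono harm_two_power_le) simp
  finally have far: "(\<Sum>n\<in>{2 ^ k..<2 ^ Suc k}. far (x n)) / 2 ^ k \<le> 16 * real (Suc k)"
    by (simp add: field_simps)
  have "(\<Sum>n\<in>{2 ^ k..<2 ^ Suc k}. 1 / (real n * x n))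
      \<le> (\<Sum>n\<in>{2 ^ k..<2 ^ Suc k}. (far (x n) + h (x n)) / 2 ^ k)"
    by (intro sum_mono term_le)
  also have "\<dots> = (\<Sum>n\<in>{2 ^ k..<2 ^ Suc k}. far (x n)) / 2 ^ k
      + (\<Sum>n\<in>{2 ^ k..<2 ^ Suc k}. h (x n)) / 2 ^ k"
    by (simp only: sum.distrib add_divide_distrib sum_divide_distrib)
  finally show ?thesis using far by (simp add: x_def h_def)
qed

lemma sum_dyadic_blocks:
  fixes f :: "nat \<Rightarrow> real"
  shows "(\<Sum>n\<in>{1..<2 ^ m}. f n) = (\<Sum>k<m. \<Sum>n\<in>{2 ^ k..<2 ^ Suc k}. f n)"
proof (induction m)
  case (Suc m)
  have "(\<Sum>n\<in>{1..<2 ^ Suc m}. f n) = (\<Sum>n\<in>{1..<2 ^ m}. f n) + (\<Sum>n\<in>{2 ^ m..<2 ^ Suc m}. f n)"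
    by (rule sum.atLeastLessThan_concat[symmetric]) auto
  then show ?case using Suc by simp
qed simp

lemma S_le_sum_dyadic_blocks:
  assumes "N < 2 ^ m"
  shows "S N \<alpha> \<gamma> \<le> (\<Sum>k<m. \<Sum>n\<in>{2 ^ k..<2 ^ Suc k}.
    1 / (real n * dist_nearest_int (real n * \<alpha> - \<gamma>)))"
proof -
  have "S N \<alpha> \<gamma> \<le> (\<Sum>n\<in>{1..<2 ^ m}. 1 / (real n * dist_nearest_int (real n * \<alpha> - \<gamma>)))"
    unfolding S_def using assms by (intro sum_mono2) (auto simp: dist_nearest_int_nonneg)
  then show ?thesis by (simp only: sum_dyadic_blocks)
qed


text \<open>For \<open>k < m\<close> the weights \<open>Suc k\<close> and \<open>(Suc k)\<^sup>2\<close> are at most \<open>m\<close> and \<open>m\<^sup>2\<close>; the first then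
  occurs \<open>m\<close> times, and the second is multiplied by at most \<open>suminf g\<close>.
  The finitely many exceptional \<open>k\<close> add a constant.\<close>
lemma sum_le_quadratic:
  fixes F g :: "nat \<Rightarrow> real"
  assumes F0: "\<And>k. 0 \<le> F k" and g0: "\<And>k. 0 \<le> g k" and g: "summable g" and c: "0 \<le> c"
    and ev: "\<forall>\<^sub>F k in sequentially. F k \<le> c * real (Suc k) + g k * (real (Suc k))\<^sup>2"
  shows "\<exists>C>0. \<forall>m\<ge>1. (\<Sum>k<m. F k) \<le> C * (real m)\<^sup>2"
proof -
  obtain k0 where k0: "\<And>k. k \<ge> k0 \<Longrightarrow> F k \<le> c * real (Suc k) + g k * (real (Suc k))\<^sup>2"
    using ev unfolding eventually_sequentially by blast
  define D where "D = (\<Sum>k<k0. F k)"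
  have D0: "0 \<le> D" by (simp add: D_def sum_nonneg F0)
  have G0: "0 \<le> suminf g" by (intro suminf_nonneg g g0)
  have "(\<Sum>k<m. F k) \<le> (D + c + suminf g + 1) * (real m)\<^sup>2" if m: "m \<ge> 1" for m
  proof -
    have "(\<Sum>k<m. F k) \<le> (\<Sum>k<m. (if k < k0 then F k else 0) + (c * real m + g k * (real m)\<^sup>2))"
    proof (intro sum_mono)
      fix k assume "k \<in> {..<m}"
      then have km: "real (Suc k) \<le> real m" by simp
      have "c * real (Suc k) + g k * (real (Suc k))\<^sup>2 \<le> c * real m + g k * (real m)\<^sup>2"
        using km c g0 by (intro add_mono mult_left_mono power_mono) auto
      then have "F k \<le> c * real m + g k * (real m)\<^sup>2" if "\<not> k < k0"
        using k0[of k] that by linarith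
      moreover have "0 \<le> c * real m + g k * (real m)\<^sup>2" using c g0 by simp
      ultimately show "F k \<le> (if k < k0 then F k else 0) + (c * real m + g k * (real m)\<^sup>2)"
        by auto
    qed
    also have "\<dots> = (\<Sum>k<m. if k < k0 then F k else 0) + (c * (real m)\<^sup>2 + (\<Sum>k<m. g k) * (real m)\<^sup>2)"
      by (simp add: sum.distrib sum_distrib_right power2_eq_square)
    also have "\<dots> \<le> D * (real m)\<^sup>2 + (c * (real m)\<^sup>2 + suminf g * (real m)\<^sup>2)"
    proof (intro add_mono order_refl mult_right_mono sum_le_suminf)
      have "(\<Sum>k<m. if k < k0 then F k else 0) = (\<Sum>k\<in>{..<m} \<inter> {..<k0}. F k)"
        by (simp add: sum.inter_restrict)
      also have "\<dots> \<le> D" unfolding D_def by (intro sum_mono2) (auto simp: F0)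
      also have "D * 1 \<le> D * (real m)\<^sup>2"
        using D0 m by (intro mult_left_mono one_le_power) auto
      finally show "(\<Sum>k<m. if k < k0 then F k else 0) \<le> D * (real m)\<^sup>2" by simp
    qed (use g0 g in auto)
    also have "\<dots> \<le> (D + c + suminf g + 1) * (real m)\<^sup>2" by (simp add: algebra_simps)
    finally show ?thesis .
  qed
  then show ?thesis using D0 c G0 by (intro exI[of _ "D + c + suminf g + 1"]) auto
qed


section \<open>The almost-sure bound\<close>
theorem theorem1p4:
  fixes \<gamma> :: real
  shows "\<exists>A :: real set. - A \<in> null_sets lebesgue \<and>
    (\<forall>\<alpha>\<in>A. (\<forall>n::nat. n \<ge> 1 \<longrightarrow> dist_nearest_int (real n * \<alpha> - \<gamma>) > 0) \<and>
      (\<exists>C>0. \<forall>\<^sub>F N in sequentially. S N \<alpha> \<gamma> \<le> C * (ln (real N))\<^sup>2))"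
proof -
  define F where "F \<alpha> k = (\<Sum>n\<in>{2 ^ k..<2 ^ Suc k}.
    1 / (real n * dist_nearest_int (real n * \<alpha> - \<gamma>)))" for \<alpha> :: real and k :: nat
  define g where "g \<alpha> k = (\<Sum>n\<in>{2 ^ k..<2 ^ Suc k}.
      layer_majorant (2 ^ gap_exp k / 2 ^ k) (2 * gap_exp k)
        (dist_nearest_int (real n * \<alpha> - \<gamma>))) / 2 ^ k / (real (Suc k))\<^sup>2"
    for \<alpha> :: real and k :: nat
  let ?good = "\<lambda>\<alpha>. (\<forall>n::nat. n \<ge> 1 \<longrightarrow> dist_nearest_int (real n * \<alpha> - \<gamma>) > 0) \<and>
      (\<exists>C>0. \<forall>\<^sub>F N in sequentially. S N \<alpha> \<gamma> \<le> C * (ln (real N))\<^sup>2)"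
  have "AE \<alpha> in lborel. ?good \<alpha>"
    using AE_dist_nearest_int_pos[of 0] AE_dist_nearest_int_pos[of \<gamma>] AE_eventually_gap[of 0]
      AE_eventually_gap[of \<gamma>] AE_summable_layer_majorant[of \<gamma>]
  proof eventually_elim
    fix \<alpha> :: real
    assume pos0: "\<forall>n\<ge>1. 0 < dist_nearest_int (real n * \<alpha> - 0)"
      and pos: "\<forall>n\<ge>1. 0 < dist_nearest_int (real n * \<alpha> - \<gamma>)"
      and gap0: "\<forall>\<^sub>F k in sequentially. \<forall>n\<in>{2 ^ k..<2 ^ Suc k}.
        1 / (2 ^ k * 2 ^ gap_exp k) < dist_nearest_int (real n * \<alpha> - 0)"
      and gap: "\<forall>\<^sub>F k in sequentially. \<forall>n\<in>{2 ^ k..<2 ^ Suc k}.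
        1 / (2 ^ k * 2 ^ gap_exp k) < dist_nearest_int (real n * \<alpha> - \<gamma>)"
      and "summable (\<lambda>k. (\<Sum>n\<in>{2 ^ k..<2 ^ Suc k}.
        layer_majorant (2 ^ gap_exp k / 2 ^ k) (2 * gap_exp k)
          (dist_nearest_int (real n * \<alpha> - \<gamma>))) / 2 ^ k / (real (Suc k))\<^sup>2)"
    then have g: "summable (g \<alpha>)" by (simp add: g_def[abs_def])
    have F0: "0 \<le> F \<alpha> k" for k
      by (simp add: F_def sum_nonneg dist_nearest_int_nonneg)
    have g0: "0 \<le> g \<alpha> k" for k
      by (simp add: g_def sum_nonneg layer_majorant_nonneg)
    have "\<forall>\<^sub>F k in sequentially. \<exists>(q::nat) (p::int). 0 < q \<and> q \<le> 2 ^ k \<and> coprime p (int q) \<and>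
        \<bar>real q * \<alpha> - of_int p\<bar> < 1 / 2 ^ k \<and> 2 ^ k \<le> real q * 2 ^ gap_exp k"
      using pos0 gap0 by (intro eventually_good_denominator) auto
    with gap have "\<forall>\<^sub>F k in sequentially. F \<alpha> k \<le> 16 * real (Suc k) + g \<alpha> k * (real (Suc k))\<^sup>2"
    proof eventually_elim
      case (elim k)
      then obtain q p where "0 < q" "q \<le> 2 ^ k" "coprime p (int q)"
        "\<bar>real q * \<alpha> - of_int p\<bar> < 1 / 2 ^ k" "2 ^ k \<le> real q * 2 ^ gap_exp k"
        by blast
      from sum_dyadic_block_le[OF this, of \<gamma>] elim(1) show ?case
        by (simp add: F_def g_def)
    qed
    from sum_le_quadratic[OF F0 g0 g _ this] obtain C
      where C: "C > 0" "\<And>m. m \<ge> 1 \<Longrightarrow> (\<Sum>k<m. F \<alpha> k) \<le> C * (real m)\<^sup>2"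
      by auto
    have "S N \<alpha> \<gamma> \<le> (16 * C) * (ln (real N))\<^sup>2" if N: "N \<ge> 2" for N
    proof -
      obtain k where k: "2 ^ k \<le> N" "N < 2 ^ Suc k"
        using ex_power_ivl1[of 2 N] N by auto
      have "k \<noteq> 0" using k N by (cases k) auto
      have "S N \<alpha> \<gamma> \<le> (\<Sum>k<Suc k. F \<alpha> k)"
        unfolding F_def by (rule S_le_sum_dyadic_blocks[OF k(2)])
      also have "\<dots> \<le> C * (real (Suc k))\<^sup>2" by (rule C(2)) simp
      also have "\<dots> \<le> C * (4 * ln (real N))\<^sup>2"
      proof (intro mult_left_mono power_mono)
        have "real (2 ^ k) \<le> real N" using k(1) by (simp only: of_nat_le_iff)
        then have "ln (real (2 ^ k)) \<le> ln (real N)" by (intro ln_mono) auto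
        then have "real k * ln 2 \<le> ln (real N)" by (simp add: ln_realpow)
        moreover have "real k * (1 / 2) \<le> real k * ln 2"
          using ln2_ge_two_thirds by (intro mult_left_mono) auto
        (* 1 / 2 \<le> ln 2, and k \<ge> 1 allows Suc k \<le> 2 * k. *)
        ultimately have "real k \<le> 2 * ln (real N)" by linarith
        then show "real (Suc k) \<le> 4 * ln (real N)" using \<open>k \<noteq> 0\<close> by simp
      qed (use C in auto)
      also have "\<dots> = (16 * C) * (ln (real N))\<^sup>2" by (simp add: power_mult_distrib)
      finally show ?thesis .
    qed
    then have "\<forall>\<^sub>F N in sequentially. S N \<alpha> \<gamma> \<le> (16 * C) * (ln (real N))\<^sup>2"
      unfolding eventually_sequentially by blast
    moreover have "16 * C > 0" using C by simp
    ultimately show "?good \<alpha>" using pos by blast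
  qed
  then obtain Z where Z: "{\<alpha>. \<not> ?good \<alpha>} \<subseteq> Z" "Z \<in> null_sets lborel"
    unfolding eventually_ae_filter by auto
  have "- {\<alpha>. ?good \<alpha>} \<in> null_sets lebesgue"
    using Z by (intro null_sets_completion_subset[OF _ null_sets_completionI[OF Z(2)]]) auto
  then show ?thesis by (intro exI[of _ "{\<alpha>. ?good \<alpha>}"]) simp
qed

end
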